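(* The language $\mathbf{DELKh}$ is equally expressive as its fragment $\mathbf{EL}$ over models: for every $\varphi\in\mathbf{DELKh}$ there is $\psi\in\mathbf{EL}$ such that for every model $M$ and every world $w$ of $M$, $M,w\vDash\varphi$ if and only if $M,w\vDash\psi$ (and, conversely, every $\mathbf{EL}$-formula is equivalent in this sense to a $\mathbf{DELKh}$-formula).
   Context: Fix a countable set $\mathbf{P}$ of proposition letters. $\mathbf{PL}$: $\alpha::=p\mid\bot\mid(\alpha\land\alpha)\mid(\alpha\lor\alpha)\mid(\alpha\to\alpha)$, $p\in\mathbf{P}$. $\mathbf{DELKh}$: $\varphi::=p\mid\bot\mid(\varphi\land\varphi)\mid(\varphi\lor\varphi)\mid(\varphi\to\varphi)\mid\mathsf{K}\varphi\mid\mathsf{Kh}\alpha\mid\Box\varphi$, with $p\in\mathbf{P}$, $\alpha\in\mathbf{PL}$. $\mathbf{EL}$ is the fragment of $\mathbf{DELKh}$ consisting of formulas containing neither $\mathsf{Kh}$ nor $\Box$. A model (epistemic model) is $M=\langle W,V\rangle$ with $W\ne\varnothing$ and $V:W\to\wp(\mathbf{P})$. A submodel of $M$ is $\langle W',V|_{W'}\rangle$ with $\varnothing\ne W'\subseteq W$. Resolution space: $S(p)=\{p\}$; $S(\bot)=\{\bot\}$; $S(\alpha\lor\beta)=(S(\alpha)\times\{0\})\cup(S(\beta)\times\{1\})$; $S(\alpha\land\beta)=S(\alpha)\times S(\beta)$; $S(\alpha\to\beta)=S(\beta)^{S(\alpha)}$. Resolutions at $w\in W$: $R(w,\bot)=\varnothing$;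 $R(w,p)=\{p\}$ if $p\in V(w)$, else $\varnothing$; $R(w,\alpha\lor\beta)=(R(w,\alpha)\times\{0\})\cup(R(w,\beta)\times\{1\})$; $R(w,\alpha\land\beta)=R(w,\alpha)\times R(w,\beta)$; $R(w,\alpha\to\beta)=\{f\in S(\beta)^{S(\alpha)}\mid f[R(w,\alpha)]\subseteq R(w,\beta)\}$. Satisfaction $M,w\vDash\varphi$: $M,w\nvDash\bot$; $M,w\vDash p$ iff $p\in V(w)$; $\land,\lor,\to$ are classical; $M,w\vDash\Box\varphi$ iff $M',w\vDash\varphi$ for every submodel $M'$ of $M$ containing $w$; $M,w\vDash\mathsf{K}\varphi$ iff $M,v\vDash\varphi$ for all $v\in W$; $M,w\vDash\mathsf{Kh}\alpha$ iff there is $x\in S(\alpha)$ with $x\in R(v,\alpha)$ for all $v\in W$. *)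

theory Defs
  imports Main "HOL-Library.Countable" "HOL-Library.FSet" "HOL-Library.FuncSet"
begin

datatype 'p pl =
    PAtom 'p
  | PBot
  | PAnd "'p pl" "'p pl"
  | POr "'p pl" "'p pl"
  | PImp "'p pl" "'p pl"

datatype 'p delkh =
    Atom 'p
  | Bot
  | And "'p delkh" "'p delkh"
  | Or "'p delkh" "'p delkh"
  | Imp "'p delkh" "'p delkh"
  | K "'p delkh"
  | Kh "'p pl"
  | Box "'p delkh"

primrec is_EL :: "'p delkh \<Rightarrow> bool" where
  "is_EL (Atom p) \<longleftrightarrow> True"
| "is_EL Bot \<longleftrightarrow> True"
| "is_EL (And \<phi> \<psi>) \<longleftrightarrow> is_EL \<phi> \<and> is_EL \<psi>"
| "is_EL (Or \<phi> \<psi>) \<longleftrightarrow> is_EL \<phi> \<and> is_EL \<psi>"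
| "is_EL (Imp \<phi> \<psi>) \<longleftrightarrow> is_EL \<phi> \<and> is_EL \<psi>"
| "is_EL (K \<phi>) \<longleftrightarrow> is_EL \<phi>"
| "is_EL (Kh \<alpha>) \<longleftrightarrow> False"
| "is_EL (Box \<phi>) \<longleftrightarrow> False"

record ('w, 'p) model =
  worlds :: "'w set"
  val :: "'w \<Rightarrow> 'p set"

definition is_model :: "('w, 'p) model \<Rightarrow> bool" where
  "is_model M \<longleftrightarrow> worlds M \<noteq> {}"

text \<open>Valuations are total on the type of worlds, but their values outside \<^term>\<open>worlds M\<close> are never
  consulted by the semantics, so restricting the valuation to a submodel needs no change to it.\<close>

definition submodel :: "('w, 'p) model \<Rightarrow> ('w, 'p) model \<Rightarrow> bool" where
  "submodel N M \<longleftrightarrow> worlds N \<noteq> {} \<and> worlds N \<subseteq> worlds M \<and> val N = val M"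

text \<open>A common type for the elements of all resolution spaces. \<open>RInl x\<close> and \<open>RInr y\<close> stand for
  \<open>(x, 0)\<close> and \<open>(y, 1)\<close>. A function is represented by its graph; a finite graph suffices since
  all resolution spaces are finite (lemma \<open>finite_res_space\<close> below).\<close>

datatype 'p res =
    RAtom 'p
  | RBot
  | RInl "'p res"
  | RInr "'p res"
  | RPair "'p res" "'p res"
  | RFun "('p res \<times> 'p res) fset"

definition is_graph :: "('a \<times> 'b) fset \<Rightarrow> 'a set \<Rightarrow> ('a \<Rightarrow> 'b) \<Rightarrow> bool" where
  "is_graph G A f \<longleftrightarrow> fset G = (\<lambda>x. (x, f x)) ` A"

primrec res_space :: "'p pl \<Rightarrow> 'p res set" where
  "res_space (PAtom p) = {RAtom p}"
| "res_space PBot = {RBot}"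
| "res_space (POr \<alpha> \<beta>) = RInl ` res_space \<alpha> \<union> RInr ` res_space \<beta>"
| "res_space (PAnd \<alpha> \<beta>) = {RPair x y | x y. x \<in> res_space \<alpha> \<and> y \<in> res_space \<beta>}"
| "res_space (PImp \<alpha> \<beta>) =
     {RFun G | G f. f \<in> res_space \<alpha> \<rightarrow> res_space \<beta> \<and> is_graph G (res_space \<alpha>) f}"

primrec resolutions :: "('w, 'p) model \<Rightarrow> 'w \<Rightarrow> 'p pl \<Rightarrow> 'p res set" where
  "resolutions M w (PAtom p) = (if p \<in> val M w then {RAtom p} else {})"
| "resolutions M w PBot = {}"
| "resolutions M w (POr \<alpha> \<beta>) = RInl ` resolutions M w \<alpha> \<union> RInr ` resolutions M w \<beta>"
| "resolutions M w (PAnd \<alpha> \<beta>) =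
     {RPair x y | x y. x \<in> resolutions M w \<alpha> \<and> y \<in> resolutions M w \<beta>}"
| "resolutions M w (PImp \<alpha> \<beta>) =
     {RFun G | G f. f \<in> res_space \<alpha> \<rightarrow> res_space \<beta> \<and> is_graph G (res_space \<alpha>) f
                    \<and> f ` resolutions M w \<alpha> \<subseteq> resolutions M w \<beta>}"

lemma finite_res_space: "finite (res_space \<alpha>)"
proof (induction \<alpha>)
  case (PAnd \<alpha> \<beta>)
  have "res_space (PAnd \<alpha> \<beta>) = (\<lambda>(x, y). RPair x y) ` (res_space \<alpha> \<times> res_space \<beta>)"
    by auto
  with PAnd show ?case by simp
next
  case (PImp \<alpha> \<beta>)
  let ?D = "{G. fset G \<subseteq> res_space \<alpha> \<times> res_space \<beta>}"
  have "inj_on fset ?D" by (simp add: inj_on_def fset_inject)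
  moreover have "fset ` ?D \<subseteq> Pow (res_space \<alpha> \<times> res_space \<beta>)" by auto
  ultimately have "finite ?D"
    using PImp by (meson finite_Pow_iff finite_SigmaI finite_imageD finite_subset)
  moreover have "res_space (PImp \<alpha> \<beta>) \<subseteq> RFun ` ?D"
    by (force simp: is_graph_def)
  ultimately show ?case by (meson finite_imageI finite_subset)
qed simp_all

text \<open>Hence every function between resolution spaces is represented.\<close>

lemma ex1_graph: "\<exists>!G. is_graph G (res_space \<alpha>) f"
proof -
  have "finite ((\<lambda>x. (x, f x)) ` res_space \<alpha>)"
    by (simp add: finite_res_space)
  then obtain G where "fset G = (\<lambda>x. (x, f x)) ` res_space \<alpha>"
    by (metis fset_cases mem_Collect_eq)
  then show ?thesis by (auto simp: is_graph_def fset_inject)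
qed

primrec sat :: "('w, 'p) model \<Rightarrow> 'w \<Rightarrow> 'p delkh \<Rightarrow> bool" where
  "sat M w (Atom p) \<longleftrightarrow> p \<in> val M w"
| "sat M w Bot \<longleftrightarrow> False"
| "sat M w (And \<phi> \<psi>) \<longleftrightarrow> sat M w \<phi> \<and> sat M w \<psi>"
| "sat M w (Or \<phi> \<psi>) \<longleftrightarrow> sat M w \<phi> \<or> sat M w \<psi>"
| "sat M w (Imp \<phi> \<psi>) \<longleftrightarrow> (sat M w \<phi> \<longrightarrow> sat M w \<psi>)"
| "sat M w (K \<phi>) \<longleftrightarrow> (\<forall>v\<in>worlds M. sat M v \<phi>)"
| "sat M w (Kh \<alpha>) \<longleftrightarrow> (\<exists>x\<in>res_space \<alpha>. \<forall>v\<in>worlds M. x \<in> resolutions M v \<alpha>)"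
| "sat M w (Box \<phi>) \<longleftrightarrow> (\<forall>N. submodel N M \<and> w \<in> worlds N \<longrightarrow> sat N w \<phi>)"

text \<open>Equivalence over all models whose worlds are drawn from the type \<open>'w\<close>. HOL cannot quantify
  over types inside a formula, so the type is a parameter, and \<open>\<exists>\<psi>. equivalent_over TYPE('w) \<phi> \<psi>\<close>
  alone would let \<open>\<psi>\<close> depend on \<open>'w\<close>. One \<open>\<psi>\<close> for models of every type is obtained by additionally
  requiring that \<open>equivalent_over TYPE('p set) \<phi> \<psi>\<close> implies \<open>equivalent_over TYPE('w) \<phi> \<psi>\<close>: then
  a witness for the fixed type \<open>'p set\<close> works for all \<open>'w\<close>.\<close>

definition equivalent_over :: "'w itself \<Rightarrow> 'p delkh \<Rightarrow> 'p delkh \<Rightarrow> bool" where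
  "equivalent_over (_ :: 'w itself) \<phi> \<psi> \<longleftrightarrow>
     (\<forall>(M :: ('w, 'p) model) w. is_model M \<and> w \<in> worlds M \<longrightarrow> (sat M w \<phi> \<longleftrightarrow> sat M w \<psi>))"

end

theory Submission
  imports Defs
begin

text \<open>Truth of a formula at a world depends only on the valuation at that world, together with the
  set of valuations realised in the model, both restricted to the atoms of the formula. Over
  finitely many atoms there are finitely many such pairs, and each of them is definable in epistemic
  logic, so every formula is equivalent to a finite disjunction of epistemic formulas. Without the
  restriction to finitely many atoms, the same invariance lets every model be replaced by the set of
  its valuations, which reduces arbitrary types of worlds to \<^typ>\<open>'p set\<close>.\<close>

section \<open>Invariance of truth under equal profiles\<close>

abbreviation profile :: "'p set \<Rightarrow> ('w, 'p) model \<Rightarrow> 'w \<Rightarrow> 'p set" where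
  "profile Q M w \<equiv> val M w \<inter> Q"

abbreviation profiles :: "'p set \<Rightarrow> ('w, 'p) model \<Rightarrow> 'p set set" where
  "profiles Q M \<equiv> profile Q M ` worlds M"

text \<open>Only the atomic clause consults the valuation; the spaces \<open>res_space\<close>
  between which implications map are the same at every world.\<close>

lemma resolutions_cong:
  assumes "val M w \<inter> set_pl \<alpha> = val M' w' \<inter> set_pl \<alpha>"
  shows "resolutions M w \<alpha> = resolutions M' w' \<alpha>"
  using assms
proof (induction \<alpha>)
  case (PAtom p)
  then have "p \<in> val M w \<longleftrightarrow> p \<in> val M' w'" by auto
  then show ?case by simp
next
  case (PAnd \<alpha> \<beta>)
  have "resolutions M w \<alpha> = resolutions M' w' \<alpha>" "resolutions M w \<beta> = resolutions M' w' \<beta>"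
    using PAnd.prems by (intro PAnd.IH; auto)+
  then show ?case by simp
next
  case (POr \<alpha> \<beta>)
  have "resolutions M w \<alpha> = resolutions M' w' \<alpha>" "resolutions M w \<beta> = resolutions M' w' \<beta>"
    using POr.prems by (intro POr.IH; auto)+
  then show ?case by simp
next
  case (PImp \<alpha> \<beta>)
  have "resolutions M w \<alpha> = resolutions M' w' \<alpha>" "resolutions M w \<beta> = resolutions M' w' \<beta>"
    using PImp.prems by (intro PImp.IH; auto)+
  then show ?case by simp
qed simp

text \<open>The back-and-forth step for \<open>Box\<close>: cutting down one model can be imitated
  in the other without disturbing the invariant.\<close>

lemma submodel_transfer:
  assumes "submodel N M" "w \<in> worlds N" "w' \<in> worlds M'"
    and "profile Q M w = profile Q M' w'" "profiles Q M = profiles Q M'"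
  obtains N' where "submodel N' M'" "w' \<in> worlds N'" "profile Q N w = profile Q N' w'"
    "profiles Q N = profiles Q N'"
proof
  \<comment> \<open>All worlds of \<open>M'\<close> whose profile survives in \<open>N\<close>.
    Every profile of \<open>N\<close> is one of \<open>M\<close> and hence of \<open>M'\<close>, so
    none is lost.\<close>
  let ?N' = "\<lparr>worlds = {v \<in> worlds M'. profile Q M' v \<in> profiles Q N}, val = val M'\<rparr>"
  have NM: "val N = val M" "worlds N \<subseteq> worlds M"
    using assms(1) by (auto simp: submodel_def)
  show w': "w' \<in> worlds ?N'"
    using assms(2-4) NM by (auto intro: rev_image_eqI)
  then show "submodel ?N' M'"
    unfolding submodel_def by auto
  show "profile Q N w = profile Q ?N' w'"
    using assms(4) NM by simp
  have "profiles Q N \<subseteq> profiles Q M'"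
    unfolding assms(5)[symmetric] NM(1) using NM(2) by (rule image_mono)
  then have "profiles Q N = {s \<in> profiles Q M'. s \<in> profiles Q N}"
    by blast
  also have "\<dots> = profiles Q ?N'"
    by auto
  finally show "profiles Q N = profiles Q ?N'" .
qed

text \<open>Equal sets of profiles give every world of either model a partner with the same profile
  in the other.\<close>

lemma ball_worlds_cong:
  assumes "profiles Q M = profiles Q M'"
    and P: "\<And>v v'. \<lbrakk>v \<in> worlds M; v' \<in> worlds M'; profile Q M v = profile Q M' v'\<rbrakk> \<Longrightarrow> P v \<longleftrightarrow> P' v'"
  shows "(\<forall>v\<in>worlds M. P v) \<longleftrightarrow> (\<forall>v\<in>worlds M'. P' v)"
proof (intro iffI ballI)
  fix v' assume all: "\<forall>v\<in>worlds M. P v" and v': "v' \<in> worlds M'"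
  then have "profile Q M' v' \<in> profiles Q M"
    unfolding assms(1) by simp
  then obtain v where "v \<in> worlds M" "profile Q M v = profile Q M' v'" by auto
  then show "P' v'" using P all v' by blast
next
  fix v assume all: "\<forall>v\<in>worlds M'. P' v" and v: "v \<in> worlds M"
  then have "profile Q M v \<in> profiles Q M'"
    unfolding assms(1)[symmetric] by simp
  then obtain v' where "v' \<in> worlds M'" "profile Q M v = profile Q M' v'" by auto
  then show "P v" using P all v by blast
qed

text \<open>The models and worlds vary in the induction because \<open>K\<close> moves the world and
  \<open>Box\<close> the model. Allowing any superset \<open>Q\<close> of the atoms lets all
  subformulas share one \<open>Q\<close> and admits \<open>Q = UNIV\<close>. The two models may have
  different types of worlds.\<close>

lemma sat_cong_profile:
  assumes "set_delkh \<phi> \<subseteq> Q" "w \<in> worlds M" "w' \<in> worlds M'"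
    and "profile Q M w = profile Q M' w'" "profiles Q M = profiles Q M'"
  shows "sat M w \<phi> \<longleftrightarrow> sat M' w' \<phi>"
  using assms
proof (induction \<phi> arbitrary: M M' w w')
  case (Atom p)
  then show ?case by auto
next
  case (And \<phi> \<psi>)
  show ?case using And.IH[OF _ And.prems(2-5)] And.prems(1) by simp
next
  case (Or \<phi> \<psi>)
  show ?case using Or.IH[OF _ Or.prems(2-5)] Or.prems(1) by simp
next
  case (Imp \<phi> \<psi>)
  show ?case using Imp.IH[OF _ Imp.prems(2-5)] Imp.prems(1) by simp
next
  case (K \<phi>)
  have IH: "sat M v \<phi> \<longleftrightarrow> sat M' v' \<phi>"
    if "v \<in> worlds M" "v' \<in> worlds M'" "profile Q M v = profile Q M' v'" for v v'
    using K.IH[OF _ that K.prems(5)] K.prems(1) by simp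
  show ?case
    unfolding sat.simps by (rule ball_worlds_cong[OF K.prems(5) IH])
next
  case (Kh \<alpha>)
  have res: "resolutions M v \<alpha> = resolutions M' v' \<alpha>"
    if "profile Q M v = profile Q M' v'" for v v'
    by (rule resolutions_cong) (use Kh.prems(1) that in auto)
  \<comment> \<open>With the witness \<open>x\<close> of \<open>Kh\<close> fixed first, uniform
    solvability is a universal statement over worlds, as for \<open>K\<close>.\<close>
  have "(\<forall>v\<in>worlds M. x \<in> resolutions M v \<alpha>) \<longleftrightarrow> (\<forall>v\<in>worlds M'. x \<in> resolutions M' v \<alpha>)" for x
    by (rule ball_worlds_cong[OF Kh.prems(5)]) (metis res)
  then show ?case by simp
next
  case (Box \<phi>)
  have \<phi>: "set_delkh \<phi> \<subseteq> Q" using Box.prems(1) by simp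
  show ?case
  proof
    assume sat: "sat M w (Box \<phi>)"
    show "sat M' w' (Box \<phi>)"
      unfolding sat.simps
    proof (intro allI impI, elim conjE)
      fix N' assume N': "submodel N' M'" "w' \<in> worlds N'"
      obtain N where N: "submodel N M" "w \<in> worlds N"
        "profile Q N' w' = profile Q N w" "profiles Q N' = profiles Q N"
        \<comment> \<open>The transfer runs here from \<open>M'\<close> back to
          \<open>M\<close>.\<close>
        using submodel_transfer[OF N' Box.prems(2) Box.prems(4,5)[symmetric]] .
      then have "sat N w \<phi>" using sat by simp
      then show "sat N' w' \<phi>"
        using Box.IH[OF \<phi> N(2) N'(2) N(3,4)[symmetric]] by blast
    qed
  next
    assume sat: "sat M' w' (Box \<phi>)"
    show "sat M w (Box \<phi>)"
      unfolding sat.simps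
    proof (intro allI impI, elim conjE)
      fix N assume N: "submodel N M" "w \<in> worlds N"
      obtain N' where N': "submodel N' M'" "w' \<in> worlds N'"
        "profile Q N w = profile Q N' w'" "profiles Q N = profiles Q N'"
        using submodel_transfer[OF N Box.prems(3) Box.prems(4,5)] .
      then have "sat N' w' \<phi>" using sat by simp
      then show "sat N w \<phi>"
        using Box.IH[OF \<phi> N(2) N'(2-4)] by blast
    qed
  qed
qed simp

section \<open>Models whose worlds are valuations\<close>

definition profile_model :: "'p set set \<Rightarrow> ('p set, 'p) model" where
  "profile_model X = \<lparr>worlds = X, val = id\<rparr>"

text \<open>Each profile is a world that is its own valuation, and intersecting it with
  \<open>Q\<close> again changes nothing, so the invariance lemma applies.\<close>

lemma sat_profile_model:
  assumes "set_delkh \<phi> \<subseteq> Q" "w \<in> worlds M"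
  shows "sat M w \<phi> \<longleftrightarrow> sat (profile_model (profiles Q M)) (profile Q M w) \<phi>"
  using assms by (intro sat_cong_profile[where Q = Q]) (auto simp: profile_model_def image_image)

section \<open>Properties of pointed models definable in epistemic logic\<close>

text \<open>Phrased for semantic properties, so that closure lemmas assemble a formula without
  writing it out.\<close>

definition EL_definable :: "(('w, 'p) model \<Rightarrow> 'w \<Rightarrow> bool) \<Rightarrow> bool" where
  "EL_definable P \<longleftrightarrow> (\<exists>\<psi>. is_EL \<psi> \<and> (\<forall>M. \<forall>w\<in>worlds M. sat M w \<psi> \<longleftrightarrow> P M w))"

lemma EL_definable_atom: "EL_definable (\<lambda>M w. p \<in> val M w)"
  unfolding EL_definable_def by (rule exI[of _ "Atom p"]) simp

lemma EL_definable_const: "EL_definable (\<lambda>M w. b)"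
  unfolding EL_definable_def
  by (rule exI[of _ "if b then Imp Bot Bot else Bot"]) simp

lemma EL_definable_not:
  assumes "EL_definable P"
  shows "EL_definable (\<lambda>M w. \<not> P M w)"
proof -
  obtain \<psi> where "is_EL \<psi>" "\<forall>M. \<forall>w\<in>worlds M. sat M w \<psi> \<longleftrightarrow> P M w"
    using assms by (auto simp: EL_definable_def)
  then show ?thesis
    unfolding EL_definable_def by (intro exI[of _ "Imp \<psi> Bot"]) simp
qed

lemma EL_definable_conj:
  assumes "EL_definable P" "EL_definable Q"
  shows "EL_definable (\<lambda>M w. P M w \<and> Q M w)"
proof -
  obtain \<psi> \<chi> where "is_EL \<psi>" "\<forall>M. \<forall>w\<in>worlds M. sat M w \<psi> \<longleftrightarrow> P M w"
    and "is_EL \<chi>" "\<forall>M. \<forall>w\<in>worlds M. sat M w \<chi> \<longleftrightarrow> Q M w"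
    using assms by (auto simp: EL_definable_def)
  then show ?thesis
    unfolding EL_definable_def by (intro exI[of _ "And \<psi> \<chi>"]) simp
qed

lemma EL_definable_all_worlds:
  assumes "EL_definable P"
  shows "EL_definable (\<lambda>M w. \<forall>v\<in>worlds M. P M v)"
proof -
  obtain \<psi> where "is_EL \<psi>" "\<forall>M. \<forall>w\<in>worlds M. sat M w \<psi> \<longleftrightarrow> P M w"
    using assms by (auto simp: EL_definable_def)
  then show ?thesis
    unfolding EL_definable_def by (intro exI[of _ "K \<psi>"]) simp
qed

lemma EL_definable_ball:
  assumes "finite A" "\<And>a. a \<in> A \<Longrightarrow> EL_definable (P a)"
  shows "EL_definable (\<lambda>M w. \<forall>a\<in>A. P a M w)"
  using assms
proof (induction A)
  case empty
  show ?case using EL_definable_const[of True] by simp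
next
  case (insert a A)
  then show ?case by (simp add: EL_definable_conj)
qed

lemma EL_definable_bex:
  assumes "finite A" "\<And>a. a \<in> A \<Longrightarrow> EL_definable (P a)"
  shows "EL_definable (\<lambda>M w. \<exists>a\<in>A. P a M w)"
  using EL_definable_not[OF EL_definable_ball[OF assms(1) EL_definable_not[OF assms(2)]]] by simp

lemma EL_definable_ex_world:
  assumes "EL_definable P"
  shows "EL_definable (\<lambda>M w. \<exists>v\<in>worlds M. P M v)"
  using EL_definable_not[OF EL_definable_all_worlds[OF EL_definable_not[OF assms]]] by simp

lemma EL_definable_profile:
  assumes "finite Q"
  shows "EL_definable (\<lambda>(M :: ('w, 'p) model) w. profile Q M w = t)"
proof -
  have "EL_definable (\<lambda>(M :: ('w, 'p) model) w. p \<in> val M w \<longleftrightarrow> p \<in> t)" for p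
    by (cases "p \<in> t") (simp_all add: EL_definable_atom EL_definable_not)
  \<comment> \<open>The constant conjunct \<open>t \<subseteq> Q\<close> makes the property false
    when \<open>t\<close> cannot be a profile.\<close>
  then have "EL_definable (\<lambda>(M :: ('w, 'p) model) w. t \<subseteq> Q \<and> (\<forall>p\<in>Q. p \<in> val M w \<longleftrightarrow> p \<in> t))"
    using assms by (intro EL_definable_conj EL_definable_const EL_definable_ball)
  moreover have "t \<subseteq> Q \<and> (\<forall>p\<in>Q. p \<in> val M w \<longleftrightarrow> p \<in> t) \<longleftrightarrow> profile Q M w = t"
    for M :: "('w, 'p) model" and w
    by auto
  ultimately show ?thesis by simp
qed

text \<open>One inclusion is \<open>K\<close> of a finite disjunction, the other a finite
  conjunction of duals of \<open>K\<close>.\<close>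

lemma EL_definable_profiles:
  assumes "finite Q" "finite X"
  shows "EL_definable (\<lambda>(M :: ('w, 'p) model) w. profiles Q M = X)"
proof -
  have "EL_definable (\<lambda>(M :: ('w, 'p) model) w. (\<forall>v\<in>worlds M. \<exists>s\<in>X. profile Q M v = s) \<and>
      (\<forall>s\<in>X. \<exists>v\<in>worlds M. profile Q M v = s))"
    using assms by (intro EL_definable_conj EL_definable_all_worlds EL_definable_ball
        EL_definable_bex EL_definable_ex_world EL_definable_profile)
  moreover have "(\<forall>v\<in>worlds M. \<exists>s\<in>X. profile Q M v = s) \<and>
      (\<forall>s\<in>X. \<exists>v\<in>worlds M. profile Q M v = s) \<longleftrightarrow> profiles Q M = X"
    for M :: "('w, 'p) model"
    by auto
  ultimately show ?thesis by (simp only:)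
qed

section \<open>Translation into epistemic logic and change of the type of worlds\<close>

lemma finite_set_pl: "finite (set_pl \<alpha>)"
  by (induction \<alpha>) simp_all

lemma finite_set_delkh: "finite (set_delkh \<phi>)"
  by (induction \<phi>) (simp_all add: finite_set_pl)

lemma EL_definable_sat: "EL_definable (\<lambda>(M :: ('w, 'p) model) w. sat M w \<phi>)"
proof -
  define Q where "Q = set_delkh \<phi>"
  have "finite Q" by (simp add: Q_def finite_set_delkh)
  \<comment> \<open>The disjuncts of the translation: those of the finitely many pairs of a profile
    and a set of profiles at which \<open>\<phi>\<close> holds, as tested in the model built from
    the pair itself.\<close>
  define A where "A = {(t, X) \<in> Pow Q \<times> Pow (Pow Q). sat (profile_model X) t \<phi>}"
  have "finite A"
    by (rule finite_subset[of _ "Pow Q \<times> Pow (Pow Q)"]) (auto simp: A_def \<open>finite Q\<close>)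
  moreover have "finite (snd a)" if "a \<in> A" for a
    using that \<open>finite Q\<close> by (auto simp: A_def intro: finite_subset[of _ "Pow Q"])
  ultimately have "EL_definable (\<lambda>(M :: ('w, 'p) model) w.
      \<exists>a\<in>A. profile Q M w = fst a \<and> profiles Q M = snd a)"
    using \<open>finite Q\<close>
    by (intro EL_definable_bex EL_definable_conj EL_definable_profile EL_definable_profiles)
  moreover have "(\<exists>a\<in>A. profile Q M w = fst a \<and> profiles Q M = snd a) \<longleftrightarrow> sat M w \<phi>"
    if "w \<in> worlds M" for M :: "('w, 'p) model" and w
    using sat_profile_model[of \<phi> Q w M] that by (fastforce simp: A_def Q_def)
  ultimately show ?thesis
    unfolding EL_definable_def by simp
qed

text \<open>With \<open>Q = UNIV\<close> profiles are whole valuations, and any pointed model agrees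
  on both formulas with one whose worlds have type \<open>'p set\<close>.\<close>

lemma equivalent_over_transfer:
  fixes \<phi> \<psi> :: "'p delkh"
  assumes "equivalent_over TYPE('p set) \<phi> \<psi>"
  shows "equivalent_over TYPE('w) \<phi> \<psi>"
  unfolding equivalent_over_def
proof (intro allI impI, elim conjE)
  fix M :: "('w, 'p) model" and w
  assume w: "w \<in> worlds M"
  let ?N = "profile_model (profiles UNIV M)"
  have "is_model ?N" "profile UNIV M w \<in> worlds ?N"
    using w by (auto simp: is_model_def profile_model_def)
  then have "sat ?N (profile UNIV M w) \<phi> \<longleftrightarrow> sat ?N (profile UNIV M w) \<psi>"
    using assms unfolding equivalent_over_def by blast
  then show "sat M w \<phi> \<longleftrightarrow> sat M w \<psi>"
    using w by (simp only: sat_profile_model[where Q = UNIV] subset_UNIV)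
qed

theorem theorem41:
  "(\<forall>\<phi> :: 'p::countable delkh. \<exists>\<psi>. is_EL \<psi> \<and> equivalent_over TYPE('w) \<phi> \<psi>) \<and>
   (\<forall>\<psi> :: 'p delkh. is_EL \<psi> \<longrightarrow> (\<exists>\<phi> :: 'p delkh. equivalent_over TYPE('w) \<psi> \<phi>)) \<and>
   (\<forall>(\<phi> :: 'p delkh) \<psi>. is_EL \<psi> \<and> equivalent_over TYPE('p set) \<phi> \<psi>
      \<longrightarrow> equivalent_over TYPE('w) \<phi> \<psi>)"
proof (intro conjI allI impI)
  fix \<phi> :: "'p delkh"
  show "\<exists>\<psi>. is_EL \<psi> \<and> equivalent_over TYPE('w) \<phi> \<psi>"
    using EL_definable_sat[where 'w = 'w, of \<phi>]
    unfolding EL_definable_def equivalent_over_def by blast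
next
  fix \<psi> :: "'p delkh"
  show "\<exists>\<phi>. equivalent_over TYPE('w) \<psi> \<phi>"
    \<comment> \<open>The witness is \<open>\<psi>\<close> itself, since epistemic formulas already
      belong to the full language.\<close>
    unfolding equivalent_over_def by blast
next
  fix \<phi> \<psi> :: "'p delkh"
  assume "is_EL \<psi> \<and> equivalent_over TYPE('p set) \<phi> \<psi>"
  then show "equivalent_over TYPE('w) \<phi> \<psi>"
    using equivalent_over_transfer by blast
qed

end
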